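(* Let $\mathscr{P}=\{P_{\theta,\eta}:\theta\in\Theta,\eta\in H\}$ be a dominated model for data $X_1,X_2,\ldots$ assumed distributed i.i.d.-$P_0$ for some $P_0=P_{\theta_0,\eta_0}\in\mathscr{P}$ in the Hellinger support of the prior $\Pi$, and let $g$ be a metric on $\Theta$. Suppose that for every $\epsilon>0$ the set $V=\{P_{\theta,\eta}\in\mathscr{P}:g(\theta,\theta_0)>\epsilon,\eta\in H\}$ has a finite cover $V_1,\ldots,V_N$ for which there exist model subsets $B_1,\ldots,B_N$ such that for every $1\leq i\leq N$: $\pi_{P_0}(\mathrm{co}(V_i),B_i)<1$, $\Pi(B_i)>0$, and $\sup_{Q\in B_i}P_0(dP/dQ)<\infty$ for all $P\in V_i$. Then the posterior is marginally consistent, $P_0$-almost surely, i.e. for all $\epsilon>0$, \[ \Pi\bigl(P_{\theta,\eta}\in\mathscr{P}:g(\theta,\theta_0)>\epsilon,\eta\in H\bigm|X_1,\ldots,X_n\bigr)\longrightarrow0,\qquad P_0\text{-almost surely}. \]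
   Context: Setting. $\Theta$ is an open subset of $\mathbb{R}^k$ (parameter of interest) and $H$ is a measurable, typically infinite-dimensional, parameter space (nuisance parameter). $(\theta,\eta)\mapsto P_{\theta,\eta}$ is a Markov kernel into the sample space $(\mathscr{X},\mathscr{A})$; the model is dominated by a $\sigma$-finite measure $\mu$, with densities $p=dP/d\mu$ (taken jointly measurable; model subsets to which $\Pi$ is applied, including the $V_i$, are measurable). The prior $\Pi$ is a probability measure on $\Theta\times H$ (equivalently on $\mathscr{P}$). Notation: $P_0f=\int f\,dP_0$. The posterior is \[ \Pi(A\mid X_1,\ldots,X_n)=\int_A\prod_{i=1}^n p(X_i)\,d\Pi(P)\Bigm/\int_{\mathscr{P}}\prod_{i=1}^n p(X_i)\,d\Pi(P). \] "$P_0$-almost surely" refers to $P_0^\infty$. $P_0$ lies in the Hellinger support of $\Pi$ if $\Pi(U)>0$ for every neighbourhood $U$ of $P_0$ in the metric $\bigl(\int(\sqrt p-\sqrt q)^2\,d\mu\bigr)^{1/2}$. $\mathrm{co}(V)$ is the convex hull of $V$. For sets $W,B$ of probability measures, $\pi_{P_0}(W,B)=\inf_{\alpha\in[0,1]}\sup_{P\in W}\sup_{Q\in B}P_0(dP/dQ)^\alpha$. Conventions: $P_0(dP/dQ)^\alpha=\int_{\{p_0>0,\,p>0\}}(p/q)^\alpha\,dP_0$; finiteness of $P_0(dP/dQ)$ includes that $q>0$ $P_0$-almost everywhere on $\{p>0\}$; for $\alpha=0$ the expression equals $P_0(p>0)$. *)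

theory Defs
  imports "HOL-Probability.Probability"
begin

text \<open>
  A model is a map \<open>P\<close> from a parameter space to probability measures. The prior is a measure on the
  parameter space; a model subset is a set of measures, and the prior is applied to it
  through its preimage under \<open>P\<close>.
\<close>

definition model_events :: "('t \<Rightarrow> 'x measure) \<Rightarrow> 't measure \<Rightarrow> 'x measure set set" where
  "model_events P prior = {A. A \<subseteq> P ` space prior \<and> P -` A \<inter> space prior \<in> sets prior}"

definition prior_prob :: "('t \<Rightarrow> 'x measure) \<Rightarrow> 't measure \<Rightarrow> 'x measure set \<Rightarrow> real" where
  "prior_prob P prior A = measure prior (P -` A \<inter> space prior)"

text \<open>
  The sequence \<open>x\<close> is the data, with \<open>x i\<close> the observation numbered \<open>i + 1\<close>. In \<open>ennreal\<close> a quotient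
  with denominator zero and numerator zero, or with both infinite, is zero; if the true
  distribution lies in the Hellinger support of the prior, this concerns only a null set of data.
\<close>

definition posterior ::
  "('t \<Rightarrow> 'x measure) \<Rightarrow> ('t \<Rightarrow> 'x \<Rightarrow> real) \<Rightarrow> 't measure \<Rightarrow> nat \<Rightarrow> (nat \<Rightarrow> 'x)
    \<Rightarrow> 'x measure set \<Rightarrow> ennreal" where
  "posterior P p prior n x A =
     (\<integral>\<^sup>+t\<in>(P -` A \<inter> space prior). (\<Prod>i<n. ennreal (p t (x i))) \<partial>prior) /
     (\<integral>\<^sup>+t. (\<Prod>i<n. ennreal (p t (x i))) \<partial>prior)"

definition dens :: "'x measure \<Rightarrow> 'x measure \<Rightarrow> 'x \<Rightarrow> real" where
  "dens \<mu> P x = enn2real (RN_deriv \<mu> P x)"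

definition hellinger_dist :: "'x measure \<Rightarrow> 'x measure \<Rightarrow> 'x measure \<Rightarrow> real" where
  "hellinger_dist \<mu> P Q = sqrt (\<integral>x. (sqrt (dens \<mu> P x) - sqrt (dens \<mu> Q x))\<^sup>2 \<partial>\<mu>)"

definition in_hellinger_support ::
  "'x measure \<Rightarrow> ('t \<Rightarrow> 'x measure) \<Rightarrow> 't measure \<Rightarrow> 'x measure \<Rightarrow> bool" where
  "in_hellinger_support \<mu> P prior P0 \<longleftrightarrow>
     (\<forall>U\<in>model_events P prior.
        (\<exists>\<delta>>0. {Q \<in> P ` space prior. hellinger_dist \<mu> P0 Q < \<delta>} \<subseteq> U) \<longrightarrow>
        prior_prob P prior U > 0)"

text \<open>Measures do not form a real vector space type, so the convex hull is written out as the set of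
  all finite mixtures.\<close>

definition measure_co :: "'x measure set \<Rightarrow> 'x measure set" where
  "measure_co V =
     {M. \<exists>(m::nat) w Q.
           (\<forall>j<m. (0::real) \<le> w j \<and> Q j \<in> V \<and> sets (Q j) = sets M) \<and> (\<Sum>j<m. w j) = 1 \<and>
           (\<forall>A\<in>sets M. emeasure M A = (\<Sum>j<m. ennreal (w j) * emeasure (Q j) A))}"

text \<open>
  The value of \<open>(a / b)\<^sup>\<alpha>\<close> for \<open>a > 0\<close>, \<open>b \<ge> 0\<close>, \<open>\<alpha> \<ge> 0\<close>: infinite if \<open>b = 0 < \<alpha>\<close>, and one if
  \<open>\<alpha> = 0\<close>. (The library has \<open>a / 0 = 0\<close> and \<open>0 powr 0 = 0\<close> on the reals.)
\<close>

definition ratio_powr :: "real \<Rightarrow> real \<Rightarrow> real \<Rightarrow> ennreal" where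
  "ratio_powr \<alpha> a b =
     (if \<alpha> = 0 then 1 else if b = 0 then \<top> else ennreal ((a / b) powr \<alpha>))"

text \<open>\<open>P0 (dP/dQ)\<^sup>\<alpha>\<close>\<close>

definition ratio_moment ::
  "'x measure \<Rightarrow> 'x measure \<Rightarrow> real \<Rightarrow> 'x measure \<Rightarrow> 'x measure \<Rightarrow> ennreal" where
  "ratio_moment \<mu> P0 \<alpha> P Q =
     (\<integral>\<^sup>+x\<in>{x \<in> space \<mu>. dens \<mu> P0 x > 0 \<and> dens \<mu> P x > 0}.
        ratio_powr \<alpha> (dens \<mu> P x) (dens \<mu> Q x) \<partial>P0)"

definition testing_pi ::
  "'x measure \<Rightarrow> 'x measure \<Rightarrow> 'x measure set \<Rightarrow> 'x measure set \<Rightarrow> ennreal" where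
  "testing_pi \<mu> P0 W B = (INF \<alpha>\<in>{0..1}. SUP P\<in>W. SUP Q\<in>B. ratio_moment \<mu> P0 \<alpha> P Q)"

definition marginal_far_set ::
  "'a set \<Rightarrow> 'h measure \<Rightarrow> ('a \<times> 'h \<Rightarrow> 'x measure) \<Rightarrow> ('a \<Rightarrow> 'a \<Rightarrow> real) \<Rightarrow> 'a \<Rightarrow> real
    \<Rightarrow> 'x measure set" where
  "marginal_far_set \<Theta> H P g \<theta>0 \<epsilon> = {P (\<theta>, \<eta>) | \<theta> \<eta>. \<theta> \<in> \<Theta> \<and> \<eta> \<in> space H \<and> g \<theta> \<theta>0 > \<epsilon>}"

end

theory Submission
  imports Defs
begin

text \<open>
  Fix one piece \<open>V\<close> of the cover with its \<open>B\<close>, and an \<open>\<alpha>\<close> for which all moments \<open>P\<^sub>0 (dP/dQ)\<^sup>\<alpha>\<close>, \<open>P\<close> in the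
  convex hull of \<open>V\<close> and \<open>Q\<close> in \<open>B\<close>, are at most \<open>\<rho> < 1\<close>. The bound passes from finite mixtures to mixtures
  by an arbitrary prior on \<open>V\<close>: averages over an i.i.d. sample from the mixing measure have a lower
  limit above the mixture density almost everywhere, and Fatou's lemma applies. Integrating out the
  observations one at a time, where each step sees a mixture of \<open>V\<close> reweighted by the likelihood of
  the observations already fixed, bounds the \<open>\<alpha>\<close>-moment of the ratio of \<open>\<integral>\<^sub>V \<Prod> p(X\<^sub>i) d\<Pi>\<close> to \<open>\<Prod> q(X\<^sub>i)\<close> by
  \<open>\<rho>\<^sup>n\<close>. As \<open>y \<mapsto> y\<^sup>-\<^sup>\<alpha>\<close> is convex, Jensen's inequality replaces \<open>\<Prod> q(X\<^sub>i)\<close> by its prior average over \<open>B\<close>. So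
  the \<open>\<alpha>\<close>-moments of the posterior mass of \<open>V\<close> are summable in the sample size.
\<close>

subsection \<open>Powers of extended nonnegative reals\<close>

text \<open>For \<open>\<alpha> = 0\<close> the values are chosen so that \<open>upow 0 a * neg_pow 0 b\<close> is the indicator of \<open>a > 0\<close>, as in
  the convention for \<open>P\<^sub>0 (dP/dQ)\<^sup>0\<close>.\<close>

definition upow :: "real \<Rightarrow> ennreal \<Rightarrow> ennreal" where
  "upow \<alpha> a = (if a = 0 then 0 else if \<alpha> = 0 then 1 else if a = \<top> then \<top>
     else ennreal (enn2real a powr \<alpha>))"

definition neg_pow :: "real \<Rightarrow> ennreal \<Rightarrow> ennreal" where
  "neg_pow \<alpha> b = (if \<alpha> = 0 then 1 else inverse (upow \<alpha> b))"

lemma measurable_upow [measurable]: "upow \<alpha> \<in> borel_measurable borel"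
  unfolding upow_def by measurable

lemma measurable_neg_pow [measurable]: "neg_pow \<alpha> \<in> borel_measurable borel"
  unfolding neg_pow_def by measurable

lemma upow_0 [simp]: "upow \<alpha> 0 = 0"
  by (simp add: upow_def)

lemma upow_1 [simp]: "upow \<alpha> 1 = 1"
  by (simp add: upow_def)

lemma upow_ennreal: "0 < r \<Longrightarrow> upow \<alpha> (ennreal r) = ennreal (r powr \<alpha>)"
  by (auto simp: upow_def)

lemma upow_pos: "0 < a \<Longrightarrow> 0 < upow \<alpha> a"
  by (cases a) (auto simp: upow_def)

lemma upow_finite: "0 \<le> \<alpha> \<Longrightarrow> a < \<top> \<Longrightarrow> upow \<alpha> a < \<top>"
  by (auto simp: upow_def)

lemma upow_mult:
  assumes "0 \<le> \<alpha>"
  shows "upow \<alpha> (a * b) = upow \<alpha> a * upow \<alpha> b"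
proof (cases a; cases b)
  fix r s :: real
  assume "0 \<le> r" "a = ennreal r" "0 \<le> s" "b = ennreal s"
  then show ?thesis
    by (auto simp: upow_def ennreal_mult' [symmetric] enn2real_mult powr_mult)
qed (use assms in \<open>auto simp: upow_def ennreal_mult_top ennreal_top_mult ennreal_mult_eq_top_iff
       less_le split: if_splits\<close>)

lemma upow_mono:
  assumes "0 \<le> \<alpha>" "a \<le> b"
  shows "upow \<alpha> a \<le> upow \<alpha> b"
proof (cases b)
  case (real s)
  with assms(2) obtain r where "a = ennreal r" "0 \<le> r" "r \<le> s"
    by (cases a) (auto simp: top_unique)
  with real assms show ?thesis
    by (auto simp: upow_def intro!: ennreal_leI powr_mono2)
qed (use assms in \<open>auto simp: upow_def top_unique less_le\<close>)

lemma upow_upow_inverse: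
  assumes "0 < \<alpha>"
  shows "upow \<alpha> (upow (1 / \<alpha>) z) = z"
proof (cases z)
  case (real r)
  then show ?thesis
    using assms by (cases "r = 0") (auto simp: upow_def powr_powr)
qed (use assms in \<open>auto simp: upow_def\<close>)

text \<open>A power is monotone and lower semicontinuous, also at \<alpha> = 0, where it is the
  indicator of the positive values. The inequality is checked level by level: each \<open>z\<close>
  below the power of \<open>a\<close> must eventually stay below the powers of
  \<open>X n\<close>.\<close>

lemma upow_Liminf:
  assumes "0 \<le> \<alpha>" "a \<le> Liminf F X"
  shows "upow \<alpha> a \<le> Liminf F (\<lambda>n. upow \<alpha> (X n))"
proof -
  have "\<forall>\<^sub>F n in F. z < upow \<alpha> (X n)" if z: "z < upow \<alpha> a" for z
  proof (cases "\<alpha> = 0")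
    case True
    have "0 < a" using z by (auto simp: zero_less_iff_neq_zero)
    then have "\<forall>\<^sub>F n in F. 0 < X n"
      using assms(2) by (intro less_LiminfD) auto
    then show ?thesis
    proof eventually_elim
      case (elim n)
      then show ?case using z \<open>0 < a\<close> True by (auto simp: upow_def split: if_splits)
    qed
  next
    case False
    with assms have \<alpha>: "0 < \<alpha>" by simp
    \<comment> \<open>The level \<open>z\<close> is pulled back through the inverse power.
      Monotonicity then gives \<open>w < a\<close>, and invertibility of the power keeps the
      inequality strict on the way back.\<close>
    define w where "w = upow (1 / \<alpha>) z"
    have w: "upow \<alpha> w = z"
      using \<alpha> by (simp add: w_def upow_upow_inverse)
    have "w < a"
      using upow_mono[OF assms(1), of a w] z w by (meson not_le)
    then have "\<forall>\<^sub>F n in F. w < X n"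
      using assms(2) by (intro less_LiminfD) auto
    then show ?thesis
    proof eventually_elim
      case (elim n)
      have "upow \<alpha> w \<noteq> upow \<alpha> (X n)"
      proof
        assume "upow \<alpha> w = upow \<alpha> (X n)"
        then have "upow (1 / \<alpha>) (upow \<alpha> w) = upow (1 / \<alpha>) (upow \<alpha> (X n))"
          by (rule arg_cong)
        then show False
          using elim upow_upow_inverse[of "1 / \<alpha>" w] upow_upow_inverse[of "1 / \<alpha>" "X n"] \<alpha>
          by simp
      qed
      then show ?case
        using upow_mono[OF assms(1), of w "X n"] elim w by (simp add: less_le)
    qed
  qed
  then show ?thesis by (simp add: le_Liminf_iff)
qed

text \<open>Finiteness excludes the product \<open>0 * \<top>\<close>: for \<alpha> > 0 the left
  side would be \<open>\<top>\<close> and the right side \<open>\<top> * 0 = 0\<close>.\<close>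

lemma neg_pow_mult:
  assumes "0 \<le> \<alpha>" "a < \<top>" "b < \<top>"
  shows "neg_pow \<alpha> (a * b) = neg_pow \<alpha> a * neg_pow \<alpha> b"
  using assms by (auto simp: neg_pow_def upow_mult intro!: ennreal_inverse_mult upow_finite)

lemma ennreal_inverse_antimono: "(a::ennreal) \<le> b \<Longrightarrow> inverse b \<le> inverse a"
  including ennreal.lifting by transfer (rule ereal_inverse_antimono)

lemma neg_pow_antimono: "0 \<le> \<alpha> \<Longrightarrow> a \<le> b \<Longrightarrow> neg_pow \<alpha> b \<le> neg_pow \<alpha> a"
  by (auto simp: neg_pow_def intro!: ennreal_inverse_antimono upow_mono)

lemma neg_pow_1 [simp]: "neg_pow \<alpha> 1 = 1"
  by (simp add: neg_pow_def)

lemma neg_pow_pos: "0 \<le> \<alpha> \<Longrightarrow> a < \<top> \<Longrightarrow> 0 < neg_pow \<alpha> a"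
  using upow_finite[of \<alpha> a] by (auto simp: neg_pow_def zero_less_iff_neq_zero)

lemma upow_mult_neg_pow:
  assumes "0 \<le> \<alpha>" "0 < a" "a < \<top>"
  shows "upow \<alpha> a * neg_pow \<alpha> a = 1"
proof (cases "\<alpha> = 0")
  case False
  then show ?thesis
    using assms upow_pos[of a \<alpha>] upow_finite[of \<alpha> a]
    by (simp add: neg_pow_def ennreal_divide_self divide_ennreal_def [symmetric])
qed (use assms in \<open>auto simp: neg_pow_def upow_def\<close>)

text \<open>The convex function \<open>s powr - \<alpha>\<close> lies above its tangent at 1, which
  has value 1 and slope \<open>- \<alpha>\<close>. This follows from \<open>ln s \<le> s - 1\<close>
  and \<open>1 + y \<le> exp y\<close>.\<close>

lemma one_plus_le_powr:
  fixes s \<alpha> :: real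
  assumes "0 < s" "0 \<le> \<alpha>"
  shows "1 + \<alpha> \<le> s powr - \<alpha> + \<alpha> * s"
proof -
  have "1 - \<alpha> * (s - 1) \<le> 1 - \<alpha> * ln s"
    using assms by (intro diff_left_mono mult_left_mono ln_le_minus_one) auto
  also have "\<dots> \<le> exp (- \<alpha> * ln s)"
    using exp_ge_add_one_self[of "- \<alpha> * ln s"] by simp
  also have "\<dots> = s powr - \<alpha>"
    using assms by (simp add: powr_def)
  finally show ?thesis by (simp add: algebra_simps)
qed

text \<open>This is the tangent inequality at \<open>c\<close>, obtained from the one at 1 with
  \<open>s = r / c\<close>. The negative slope term stands on the right, so that no truncated
  subtraction of extended numbers occurs.\<close>

lemma neg_pow_tangent:
  assumes "0 \<le> \<alpha>" "0 < c"
  shows "ennreal ((1 + \<alpha>) * c powr - \<alpha>) \<le> neg_pow \<alpha> y + ennreal (\<alpha> * c powr (- \<alpha> - 1)) * y"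
proof (cases "\<alpha> = 0")
  case True
  then show ?thesis using assms by (simp add: neg_pow_def)
next
  case False
  with assms have \<alpha>: "0 < \<alpha>" by simp
  show ?thesis
  proof (cases y)
    case top
    then show ?thesis using \<alpha> assms by (simp add: ennreal_mult_top)
  next
    case (real r)
    show ?thesis
    proof (cases "r = 0")
      case True
      then show ?thesis using real \<alpha> by (simp add: neg_pow_def)
    next
      case False
      with real have r: "0 < r" by simp
      have "(1 + \<alpha>) * c powr - \<alpha> \<le> ((r / c) powr - \<alpha> + \<alpha> * (r / c)) * c powr - \<alpha>"
        using one_plus_le_powr[of "r / c" \<alpha>] r assms by (intro mult_right_mono) auto
      also have "\<dots> = r powr - \<alpha> + \<alpha> * c powr (- \<alpha> - 1) * r"
        using r assms by (simp add: distrib_right powr_divide powr_diff)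
      finally have "ennreal ((1 + \<alpha>) * c powr - \<alpha>) \<le> ennreal (r powr - \<alpha> + \<alpha> * c powr (- \<alpha> - 1) * r)"
        by (rule ennreal_leI)
      also have "\<dots> = neg_pow \<alpha> y + ennreal (\<alpha> * c powr (- \<alpha> - 1)) * y"
        using r \<alpha> real
        by (simp add: neg_pow_def upow_ennreal inverse_ennreal powr_minus ennreal_plus ennreal_mult'
            del: ennreal_plus [symmetric])
      finally show ?thesis .
    qed
  qed
qed

text \<open>Integrate the tangent inequality at the mean \<open>c\<close> and cancel the finite term
  \<open>?k * c\<close>. For \<alpha> > 0 the tangent needs a positive finite mean: if the mean is
  \<open>\<top>\<close> the left side is 0, and if it is 0 then \<open>f\<close> vanishes almost
  everywhere and the right side is \<open>\<top>\<close>.\<close>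

lemma (in prob_space) neg_pow_jensen:
  assumes \<alpha>: "0 \<le> \<alpha>" and [measurable]: "f \<in> borel_measurable M"
  shows "neg_pow \<alpha> (\<integral>\<^sup>+x. f x \<partial>M) \<le> (\<integral>\<^sup>+x. neg_pow \<alpha> (f x) \<partial>M)"
proof (cases "\<alpha> = 0")
  case True
  then show ?thesis by (simp add: neg_pow_def emeasure_space_1)
next
  case False
  with \<alpha> have pos: "0 < \<alpha>" by simp
  show ?thesis
  proof (cases "\<integral>\<^sup>+x. f x \<partial>M")
    case top
    then show ?thesis using pos by (simp add: neg_pow_def upow_def)
  next
    case (real c)
    show ?thesis
    proof (cases "c = 0")
      case True
      with real have "AE x in M. f x = 0"
        by (simp add: nn_integral_0_iff_AE)
      then have "(\<integral>\<^sup>+x. neg_pow \<alpha> (f x) \<partial>M) = (\<integral>\<^sup>+x. \<top> \<partial>M)"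
        by (intro nn_integral_cong_AE) (auto simp: neg_pow_def pos less_imp_neq[OF pos, symmetric])
      then show ?thesis by (simp add: emeasure_space_1 top_unique)
    next
      case False
      with real have c: "0 < c" by simp
      let ?k = "\<alpha> * c powr (- \<alpha> - 1)"
      have kc: "?k * c = \<alpha> * c powr - \<alpha>"
        using c by (simp add: powr_diff)
      have "ennreal (c powr - \<alpha>) + ennreal (?k * c) = ennreal ((1 + \<alpha>) * c powr - \<alpha>)"
        using pos c by (subst ennreal_plus [symmetric]) (auto simp: kc distrib_right)
      also have "\<dots> = (\<integral>\<^sup>+x. ennreal ((1 + \<alpha>) * c powr - \<alpha>) \<partial>M)"
        by (simp add: emeasure_space_1)
      also have "\<dots> \<le> (\<integral>\<^sup>+x. neg_pow \<alpha> (f x) + ennreal ?k * f x \<partial>M)"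
        using neg_pow_tangent[OF \<alpha> c] by (intro nn_integral_mono)
      also have "\<dots> = (\<integral>\<^sup>+x. neg_pow \<alpha> (f x) \<partial>M) + ennreal (?k * c)"
        using c pos by (simp add: nn_integral_add nn_integral_cmult real ennreal_mult')
      finally have "ennreal (c powr - \<alpha>) \<le> (\<integral>\<^sup>+x. neg_pow \<alpha> (f x) \<partial>M)"
        by (simp add: ennreal_add_left_cancel_le add.commute)
      moreover have "neg_pow \<alpha> (ennreal c) = ennreal (c powr - \<alpha>)"
        using c pos by (simp add: neg_pow_def upow_ennreal inverse_ennreal powr_minus)
      ultimately show ?thesis using real by simp
    qed
  qed
qed

subsection \<open>A one-sided law of large numbers\<close>

lemma (in prob_space) indep_vars_iid_coordinates:
  assumes "finite I" "I \<noteq> {}"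
  shows "prob_space.indep_vars (\<Pi>\<^sub>M i\<in>(UNIV::'i set). M) (\<lambda>_. M) (\<lambda>i T. T i) I"
proof -
  interpret P: product_prob_space "\<lambda>_::'i. M" UNIV ..
  have "distr (\<Pi>\<^sub>M i\<in>(UNIV::'i set). M) M (\<lambda>T. T i) = M" for i
    using P.PiM_component[of i] by simp
  then show ?thesis
    using assms P.distr_PiM_restrict_finite[of I]
    by (subst P.indep_vars_iff_distr_eq_PiM') (auto simp: restrict_def)
qed

text \<open>Hoeffding's inequality makes the probabilities of a lower deviation by \<epsilon>
  geometrically small in the sample size, and Borel-Cantelli leaves only finitely many such
  deviations.\<close>

lemma (in prob_space) AE_bounded_average_gt:
  fixes g :: "'a \<Rightarrow> real"
  assumes [measurable]: "g \<in> borel_measurable M" and g: "\<And>t. 0 \<le> g t \<and> g t \<le> K"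
    and \<epsilon>: "0 < \<epsilon>"
  shows "AE T in (\<Pi>\<^sub>M i\<in>(UNIV::nat set). M).
    \<forall>\<^sub>F m in sequentially. expectation g - \<epsilon> < (\<Sum>j<m. g (T j)) / m"
proof -
  let ?S = "\<Pi>\<^sub>M i\<in>(UNIV::nat set). M"
  interpret P: product_prob_space "\<lambda>_::nat. M" UNIV ..
  \<comment> \<open>The bound is positive even if \<open>K = 0\<close>, so that the interval from 0
    to \<open>b\<close> in Hoeffding's inequality is nondegenerate.\<close>
  define b where "b = \<bar>K\<bar> + 1"
  have b: "0 < b" "\<And>t. g t \<le> b"
    using g by (auto simp: b_def) (smt (verit))
  have distr_S: "distr ?S M (\<lambda>T. T i) = M" for i
    using P.PiM_component[of i] by simp
  have expectation_S: "integral\<^sup>L ?S (\<lambda>T. g (T 0)) = expectation g"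
    by (subst distr_S[of 0, symmetric], subst integral_distr) auto
  define A where "A m = {T \<in> space ?S. (\<Sum>j<m. g (T j)) / m \<le> expectation g - \<epsilon>}" for m :: nat
  have [measurable]: "A m \<in> sets ?S" for m
    unfolding A_def by measurable
  have A: "measure ?S (A m) \<le> exp (- (2 * \<epsilon>\<^sup>2 / b\<^sup>2)) ^ m" for m
  proof (cases "m = 0")
    case True
    then show ?thesis by simp
  next
    case False
    interpret H: Hoeffding_ineq_iid ?S "{..<m}" "\<lambda>j T. g (T j)" "\<lambda>T. g (T 0)" 0 b
      "expectation g"
    proof unfold_locales
      show "P.indep_vars (\<lambda>_. borel) (\<lambda>j T. g (T j)) {..<m}"
        using False by (intro P.indep_vars_compose2[OF indep_vars_iid_coordinates]) auto
      fix i :: nat assume "i \<in> {..<m}"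
      have "distr ?S borel (\<lambda>T. g (T i)) = distr M borel g" for i
        using distr_distr[of g M borel "\<lambda>T. T i" ?S] by (simp add: distr_S comp_def)
      then show "distr ?S borel (\<lambda>T. g (T i)) = distr ?S borel (\<lambda>T. g (T 0))"
        by simp
    qed (use g b in \<open>auto simp: expectation_S\<close>)
    show ?thesis
      using H.Hoeffding_ineq_le'[of \<epsilon>] False b \<epsilon>
      by (simp add: A_def exp_of_nat_mult [symmetric] lessThan_empty_iff field_simps)
  qed
  have "summable (\<lambda>m. measure ?S (A m))"
  proof (rule summable_comparison_test')
    show "summable (\<lambda>m. exp (- (2 * \<epsilon>\<^sup>2 / b\<^sup>2)) ^ m)"
      using \<epsilon> b by (intro summable_geometric) auto
  qed (use A in auto)
  then have "AE T in ?S. \<forall>\<^sub>F m in sequentially. T \<in> space ?S - A m"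
    by (intro borel_cantelli_AE1) (auto simp: P.emeasure_eq_measure)
  then show ?thesis
  proof eventually_elim
    case (elim T)
    then show ?case
      by eventually_elim (auto simp: A_def not_le)
  qed
qed

text \<open>The function may be unbounded, take the value \<open>\<top>\<close> or have infinite
  mean. Its truncations at \<open>k\<close> obey the bounded law outside one null set, common to all
  \<open>k\<close> and all margins \<open>1 / Suc n\<close>. By monotone convergence the truncated
  means exhaust the integral, and truncation only lowers the averages.\<close>

lemma (in prob_space) AE_nn_integral_le_liminf_average:
  assumes [measurable]: "f \<in> borel_measurable M"
  shows "AE T in (\<Pi>\<^sub>M i\<in>(UNIV::nat set). M).
    (\<integral>\<^sup>+t. f t \<partial>M) \<le> liminf (\<lambda>m. (\<Sum>j<m. f (T j)) / of_nat m)"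
proof -
  define g where "g k t = enn2real (min (f t) (of_nat k))" for k :: nat and t
  have [measurable]: "g k \<in> borel_measurable M" for k
    unfolding g_def by measurable
  have ennreal_g: "ennreal (g k t) = min (f t) (of_nat k)" for k t
    unfolding g_def by (rule ennreal_enn2real) (auto simp: min_less_iff_disj of_nat_less_top)
  have g: "0 \<le> g k t \<and> g k t \<le> real k" for k t
    unfolding g_def using enn2real_mono[of "min (f t) (of_nat k)" "of_nat k"]
    by (simp add: of_nat_less_top)
  have int_g: "(\<integral>\<^sup>+t. min (f t) (of_nat k) \<partial>M) = ennreal (expectation (g k))" for k
    unfolding ennreal_g[symmetric] using g
    by (intro nn_integral_eq_integral integrable_const_bound[where B = "real k"]) auto
  have "(SUP k. min a (of_nat k)) = a" for a :: ennreal
    using inf_SUP[of a "of_nat :: nat \<Rightarrow> ennreal" UNIV]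
    by (simp add: inf_min ennreal_SUP_of_nat_eq_top)
  then have "(\<integral>\<^sup>+t. f t \<partial>M) = (\<integral>\<^sup>+t. (SUP k. min (f t) (of_nat k)) \<partial>M)"
    by simp
  also have "\<dots> = (SUP k. ennreal (expectation (g k)))"
    unfolding int_g[symmetric]
    by (rule nn_integral_monotone_convergence_SUP) (auto simp: incseq_def le_fun_def min_le_iff_disj intro: min.mono)
  finally have int_f: "(\<integral>\<^sup>+t. f t \<partial>M) = (SUP k. ennreal (expectation (g k)))" .
  have "AE T in (\<Pi>\<^sub>M i\<in>(UNIV::nat set). M). \<forall>k n.
      \<forall>\<^sub>F m in sequentially. expectation (g k) - 1 / real (Suc n) < (\<Sum>j<m. g k (T j)) / m"
    unfolding AE_all_countable using g
    by (intro allI AE_bounded_average_gt[where K = "real k" for k]) auto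
  then show ?thesis
  proof eventually_elim
    case (elim T)
    have "\<forall>\<^sub>F m in sequentially. y < (\<Sum>j<m. f (T j)) / of_nat m"
      if y: "y < (\<integral>\<^sup>+t. f t \<partial>M)" for y
    proof -
      from y obtain k where k: "y < ennreal (expectation (g k))"
        unfolding int_f less_SUP_iff by auto
      then obtain r where r: "y = ennreal r" "0 \<le> r"
        by (cases y) auto
      with k have "r < expectation (g k)"
        by (simp add: ennreal_less_iff)
      then obtain n where n: "1 / real (Suc n) < expectation (g k) - r"
        using nat_approx_posE[of "expectation (g k) - r"] by auto
      have "\<forall>\<^sub>F m in sequentially. expectation (g k) - 1 / real (Suc n) < (\<Sum>j<m. g k (T j)) / m"
        using elim by blast
      then show ?thesis
        using eventually_gt_at_top[of 0]
      proof eventually_elim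
        case (elim m)
        have "y < ennreal ((\<Sum>j<m. g k (T j)) / m)"
          using elim n r by (simp add: ennreal_less_iff)
        also have "\<dots> = (\<Sum>j<m. ennreal (g k (T j))) / of_nat m"
          using elim g
          by (simp add: divide_ennreal [symmetric] sum_nonneg sum_ennreal ennreal_of_nat_eq_real_of_nat)
        also have "\<dots> \<le> (\<Sum>j<m. f (T j)) / of_nat m"
          by (intro divide_right_mono_ennreal sum_mono) (simp add: ennreal_g)
        finally show ?case .
      qed
    qed
    then show ?case by (simp add: le_Liminf_iff)
  qed
qed

subsection \<open>From finite to arbitrary mixtures\<close>

text \<open>Multiplication by a finite \<open>h\<close> is continuous and commutes with the lower
  limit. Multiplication by \<open>\<top>\<close> jumps at 0, but there a positive lower limit
  already makes the products eventually \<open>\<top>\<close>.\<close>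

lemma ennreal_mult_right_le_Liminf:
  fixes a h :: ennreal
  assumes "a \<le> Liminf F X" "F \<noteq> bot"
  shows "a * h \<le> Liminf F (\<lambda>n. X n * h)"
proof (cases h)
  case (real r)
  have "a * h \<le> Liminf F X * h"
    by (intro mult_right_mono assms) simp
  also have "\<dots> = Liminf F (\<lambda>n. X n * h)"
  proof (intro Liminf_compose_continuous_mono [symmetric] assms)
    show "continuous_on UNIV (\<lambda>x. x * h)"
      using ennreal_continuous_on_cmult[of h UNIV "\<lambda>x. x"] real by (simp add: mult.commute)
  qed (auto simp: mono_def mult_right_mono)
  finally show ?thesis .
next
  case top
  show ?thesis
  proof (cases "a = 0")
    case False
    then have "0 < a" by (simp add: zero_less_iff_neq_zero)
    then have "\<forall>\<^sub>F n in F. 0 < X n"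
      using assms by (intro less_LiminfD) auto
    then have "\<forall>\<^sub>F n in F. \<top> \<le> X n * h"
      by eventually_elim (simp add: top ennreal_mult_top)
    then have "\<top> \<le> Liminf F (\<lambda>n. X n * h)"
      by (rule Liminf_bounded)
    then show ?thesis by (simp add: top_unique)
  qed simp
qed

text \<open>The mixing measure is replaced by the empirical measures of a sample \<open>T\<close>
  drawn from it. These are finite mixtures of elements of \<open>V\<close>, covered by
  \<open>fin\<close>, and Fatou's lemma carries the bound to the limit.\<close>

lemma (in prob_space) mixture_moment_le:
  assumes "prob_space L" and l [measurable]: "case_prod l \<in> borel_measurable (L \<Otimes>\<^sub>M M)"
    and [measurable]: "h \<in> borel_measurable M"
    and \<alpha>: "0 \<le> \<alpha>" and V: "AE t in L. t \<in> V"
    and fin: "\<And>m T. 0 < m \<Longrightarrow> (\<And>j. T j \<in> V) \<Longrightarrow>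
      (\<integral>\<^sup>+x. upow \<alpha> ((\<Sum>j<m. l (T j) x) / of_nat m) * h x \<partial>M) \<le> \<rho>"
  shows "(\<integral>\<^sup>+x. upow \<alpha> (\<integral>\<^sup>+t. l t x \<partial>L) * h x \<partial>M) \<le> \<rho>"
proof -
  interpret L: prob_space L by fact
  interpret P: product_prob_space "\<lambda>_::nat. L" UNIV ..
  let ?S = "\<Pi>\<^sub>M i\<in>(UNIV::nat set). L"
  interpret PM: pair_sigma_finite M ?S ..
  have "AE x in M. AE T in ?S. (\<integral>\<^sup>+t. l t x \<partial>L) \<le> liminf (\<lambda>m. (\<Sum>j<m. l (T j) x) / of_nat m)"
    by (intro AE_I2 L.AE_nn_integral_le_liminf_average) measurable
  \<comment> \<open>Fubini for null sets exchanges the quantifiers: the good samples first depend on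
    \<open>x\<close>, and afterwards almost every single sample serves almost all
    \<open>x\<close>.\<close>
  then have "AE T in ?S. AE x in M. (\<integral>\<^sup>+t. l t x \<partial>L) \<le> liminf (\<lambda>m. (\<Sum>j<m. l (T j) x) / of_nat m)"
    by (subst (asm) PM.AE_commute) measurable
  moreover have "AE T in ?S. \<forall>j. T j \<in> V"
    unfolding AE_all_countable using V
    by (intro allI AE_PiM_component L.prob_space_axioms) auto
  moreover have "AE T in ?S. T \<in> space ?S"
    by simp
  ultimately have "AE T in ?S. (AE x in M. (\<integral>\<^sup>+t. l t x \<partial>L) \<le> liminf (\<lambda>m. (\<Sum>j<m. l (T j) x) / of_nat m))
      \<and> (\<forall>j. T j \<in> V) \<and> T \<in> space ?S"
    by eventually_elim auto
  \<comment> \<open>An event of full probability is nonempty, so one good sample is fixed from here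
    on.\<close>
  from eventually_happens'[OF P.ae_filter_bot this] obtain T where
    T: "AE x in M. (\<integral>\<^sup>+t. l t x \<partial>L) \<le> liminf (\<lambda>m. (\<Sum>j<m. l (T j) x) / of_nat m)"
      "\<And>j. T j \<in> V" "T \<in> space ?S"
    by auto
  have [measurable]: "T j \<in> space L" for j
    using T(3) by (auto simp: space_PiM)
  have "(\<integral>\<^sup>+x. upow \<alpha> (\<integral>\<^sup>+t. l t x \<partial>L) * h x \<partial>M) \<le>
      (\<integral>\<^sup>+x. liminf (\<lambda>m. upow \<alpha> ((\<Sum>j<m. l (T j) x) / of_nat m) * h x) \<partial>M)"
    using T(1)
    by (intro nn_integral_mono_AE, eventually_elim)
      (intro ennreal_mult_right_le_Liminf upow_Liminf \<alpha>, auto)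
  also have "\<dots> \<le> liminf (\<lambda>m. \<integral>\<^sup>+x. upow \<alpha> ((\<Sum>j<m. l (T j) x) / of_nat m) * h x \<partial>M)"
    by (intro nn_integral_liminf) measurable
  also have "\<dots> \<le> Liminf sequentially (\<lambda>m::nat. \<rho>)"
  proof (intro Liminf_mono always_eventually allI)
    fix m :: nat
    \<comment> \<open>For \<open>m = 0\<close> the average is \<open>0 / 0 = 0\<close> and the
      integrand vanishes; \<open>fin\<close> speaks of positive \<open>m\<close> only.\<close>
    show "(\<integral>\<^sup>+x. upow \<alpha> ((\<Sum>j<m. l (T j) x) / of_nat m) * h x \<partial>M) \<le> \<rho>"
      using fin[of m T] T(2) by (cases "m = 0") auto
  qed
  finally show ?thesis by (simp add: Liminf_const)
qed

text \<open>After division by its total mass \<open>c\<close>, the weight \<open>f\<close> turns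
  \<nu> into a probability measure concentrated on \<open>V\<close>. Multiplicativity of
  \<open>upow\<close> takes \<open>c\<close> out of the moment. A weight of mass 0 makes both sides
  0.\<close>

lemma (in prob_space) weighted_mixture_moment_le:
  assumes "prob_space \<nu>" and l [measurable]: "case_prod l \<in> borel_measurable (\<nu> \<Otimes>\<^sub>M M)"
    and [measurable]: "h \<in> borel_measurable M" "f \<in> borel_measurable \<nu>"
    and \<alpha>: "0 \<le> \<alpha>" and f: "\<And>t. t \<in> space \<nu> \<Longrightarrow> t \<notin> V \<Longrightarrow> f t = 0" "(\<integral>\<^sup>+t. f t \<partial>\<nu>) < \<top>"
    and fin: "\<And>m T. 0 < m \<Longrightarrow> (\<And>j. T j \<in> V) \<Longrightarrow>
      (\<integral>\<^sup>+x. upow \<alpha> ((\<Sum>j<m. l (T j) x) / of_nat m) * h x \<partial>M) \<le> \<rho>"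
  shows "(\<integral>\<^sup>+x. upow \<alpha> (\<integral>\<^sup>+t. f t * l t x \<partial>\<nu>) * h x \<partial>M) \<le> \<rho> * upow \<alpha> (\<integral>\<^sup>+t. f t \<partial>\<nu>)"
proof -
  interpret \<nu>: prob_space \<nu> by fact
  define c where "c = (\<integral>\<^sup>+t. f t \<partial>\<nu>)"
  show ?thesis
  proof (cases "c = 0")
    case True
    then have f0: "AE t in \<nu>. f t = 0"
      by (simp add: c_def nn_integral_0_iff_AE)
    have "(\<integral>\<^sup>+t. f t * l t x \<partial>\<nu>) = (\<integral>\<^sup>+t. 0 \<partial>\<nu>)" for x
      using f0 by (intro nn_integral_cong_AE) auto
    then show ?thesis by simp
  next
    case False
    with f have c: "0 < c" "c < \<top>"
      by (auto simp: c_def zero_less_iff_neq_zero)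
    define L where "L = density \<nu> (\<lambda>t. f t / c)"
    have [measurable_cong]: "sets L = sets \<nu>"
      by (simp add: L_def)
    have "emeasure L (space L) = (\<integral>\<^sup>+t. f t / c \<partial>\<nu>)"
      by (auto simp: L_def emeasure_density intro!: nn_integral_cong)
    also have "\<dots> = 1"
      using c by (simp add: nn_integral_divide c_def [symmetric] ennreal_divide_self)
    finally have L: "prob_space L"
      by (rule prob_spaceI)
    have "AE t in L. t \<in> V"
    proof (subst L_def, subst AE_density)
      show "AE t in \<nu>. 0 < f t / c \<longrightarrow> t \<in> V"
        by (rule AE_I2) (use f(1) in force)
    qed measurable
    then have le: "(\<integral>\<^sup>+x. upow \<alpha> (\<integral>\<^sup>+t. l t x \<partial>L) * h x \<partial>M) \<le> \<rho>"
      by (intro mixture_moment_le[OF L _ _ \<alpha> _ fin]) measurable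
    have "(\<integral>\<^sup>+t. f t * l t x \<partial>\<nu>) = c * (\<integral>\<^sup>+t. l t x \<partial>L)" if [measurable]: "x \<in> space M" for x
    proof -
      have "c * (\<integral>\<^sup>+t. l t x \<partial>L) = (\<integral>\<^sup>+t. c * (f t / c * l t x) \<partial>\<nu>)"
        by (simp add: L_def nn_integral_density nn_integral_cmult)
      also have "\<dots> = (\<integral>\<^sup>+t. f t * l t x \<partial>\<nu>)"
        using c by (intro nn_integral_cong)
          (simp add: mult.assoc [symmetric] ennreal_times_divide ennreal_mult_divide_eq mult.commute[of c])
      finally show ?thesis ..
    qed
    then have "(\<integral>\<^sup>+x. upow \<alpha> (\<integral>\<^sup>+t. f t * l t x \<partial>\<nu>) * h x \<partial>M)
        = (\<integral>\<^sup>+x. upow \<alpha> c * (upow \<alpha> (\<integral>\<^sup>+t. l t x \<partial>L) * h x) \<partial>M)"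
      by (intro nn_integral_cong) (simp add: upow_mult \<alpha> mult.assoc)
    also have "\<dots> = upow \<alpha> c * (\<integral>\<^sup>+x. upow \<alpha> (\<integral>\<^sup>+t. l t x \<partial>L) * h x \<partial>M)"
    proof -
      interpret L: prob_space L by (fact L)
      show ?thesis by (intro nn_integral_cmult) measurable
    qed
    also have "\<dots> \<le> upow \<alpha> c * \<rho>"
      by (intro mult_left_mono le) simp
    finally show ?thesis by (simp add: c_def mult.commute)
  qed
qed

subsection \<open>Moments of integrated likelihoods\<close>

text \<open>\<open>M\<close> is the distribution of one observation and \<open>l t\<close> the
  \<mu>-density belonging to the parameter \<open>t\<close>. Finite values of \<open>l\<close> let
  negative powers factor over the observations; absolute continuity carries \<mu>-null sets over to
  \<open>M\<close>.\<close>

locale likelihood_model =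
  prior: prob_space \<nu> + truth: prob_space M + dom: sigma_finite_measure \<mu>
  for \<nu> :: "'t measure" and M :: "'x measure" and \<mu> :: "'x measure" +
  fixes l :: "'t \<Rightarrow> 'x \<Rightarrow> ennreal"
  assumes sets_M: "sets M = sets \<mu>"
    and ac: "absolutely_continuous \<mu> M"
    and l [measurable]: "case_prod l \<in> borel_measurable (\<nu> \<Otimes>\<^sub>M \<mu>)"
    and l_finite: "l t x < \<top>"
    and l_int: "t \<in> space \<nu> \<Longrightarrow> (\<integral>\<^sup>+x. l t x \<partial>\<mu>) = 1"
begin

abbreviation "S \<equiv> \<Pi>\<^sub>M i\<in>(UNIV::nat set). M"

definition lik :: "nat \<Rightarrow> (nat \<Rightarrow> 'x) \<Rightarrow> 't \<Rightarrow> ennreal" where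
  "lik n \<omega> t = (\<Prod>i<n. l t (\<omega> i))"

lemma lik_0 [simp]: "lik 0 \<omega> t = 1"
  by (simp add: lik_def)

lemma lik_Suc: "lik (Suc n) (case_nat x \<omega>) t = l t x * lik n \<omega> t"
  unfolding lik_def by (subst prod.lessThan_Suc_shift) simp

lemma lik_finite: "lik n \<omega> t < \<top>"
  unfolding lik_def by (induction n) (auto simp: ennreal_mult_less_top l_finite)

lemma measurable_l [measurable]: "case_prod l \<in> borel_measurable (\<nu> \<Otimes>\<^sub>M M)"
  using l by (simp cong: measurable_cong_sets add: sets_pair_measure_cong[OF refl sets_M])

lemma measurable_lik [measurable]: "case_prod (lik n) \<in> borel_measurable (S \<Otimes>\<^sub>M \<nu>)"
  unfolding lik_def[abs_def] by measurable

lemma space_M: "space M = space \<mu>"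
  using sets_M by (rule sets_eq_imp_space_eq)

text \<open>By Fubini the mixture has \<mu>-integral equal to the mass of \<open>f\<close>, so it is
  finite \<mu>-almost everywhere. In the induction over the sample size this keeps the reweighted
  \<open>f\<close> of finite mass.\<close>

lemma AE_mixture_finite:
  assumes [measurable]: "f \<in> borel_measurable \<nu>" and f: "(\<integral>\<^sup>+t. f t \<partial>\<nu>) < \<top>"
  shows "AE x in M. (\<integral>\<^sup>+t. f t * l t x \<partial>\<nu>) < \<top>"
proof -
  interpret pair_sigma_finite \<nu> \<mu> ..
  have "(\<integral>\<^sup>+x. \<integral>\<^sup>+t. f t * l t x \<partial>\<nu> \<partial>\<mu>) = (\<integral>\<^sup>+t. \<integral>\<^sup>+x. f t * l t x \<partial>\<mu> \<partial>\<nu>)"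
    by (rule Fubini') measurable
  also have "\<dots> = (\<integral>\<^sup>+t. f t \<partial>\<nu>)"
    by (intro nn_integral_cong) (simp add: nn_integral_cmult l_int)
  finally have "AE x in \<mu>. (\<integral>\<^sup>+t. f t * l t x \<partial>\<nu>) \<noteq> \<infinity>"
    using f by (intro nn_integral_PInf_AE) auto
  then have "AE x in M. (\<integral>\<^sup>+t. f t * l t x \<partial>\<nu>) \<noteq> \<infinity>"
    using ac sets_M absolutely_continuous_AE[of M \<mu>] by blast
  then show ?thesis
    by eventually_elim (simp add: less_top)
qed

text \<open>An i.i.d. sequence is one draw followed by an independent i.i.d. sequence; this is the
  recursion on the sample size.\<close>

lemma nn_integral_S_Suc:
  assumes F: "F \<in> borel_measurable S"
  shows "(\<integral>\<^sup>+\<omega>. F \<omega> \<partial>S) = (\<integral>\<^sup>+x. \<integral>\<^sup>+\<omega>. F (case_nat x \<omega>) \<partial>S \<partial>M)"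
proof -
  interpret S: sequence_space M ..
  have "(\<integral>\<^sup>+\<omega>. F \<omega> \<partial>S) = (\<integral>\<^sup>+\<omega>. F \<omega> \<partial>distr (M \<Otimes>\<^sub>M S) S (\<lambda>(x, \<omega>). case_nat x \<omega>))"
    by (simp add: S.PiM_iter)
  also have "\<dots> = (\<integral>\<^sup>+z. F (case z of (x, \<omega>) \<Rightarrow> case_nat x \<omega>) \<partial>(M \<Otimes>\<^sub>M S))"
    using F by (intro nn_integral_distr) measurable
  also have "\<dots> = (\<integral>\<^sup>+x. \<integral>\<^sup>+\<omega>. F (case_nat x \<omega>) \<partial>S \<partial>M)"
    using F by (subst S.P.nn_integral_fst [symmetric]) auto
  finally show ?thesis .
qed

text \<open>Induction on \<open>n\<close> for all weights \<open>f\<close> at once. The first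
  observation \<open>x\<close> is absorbed into the weight, which becomes
  \<open>f t * l t x\<close>; the induction hypothesis for this new weight treats the other
  \<open>n\<close> observations and leaves a moment in \<open>x\<close> alone.\<close>

lemma moment_le_power:
  assumes \<alpha>: "0 \<le> \<alpha>" and b [measurable]: "b \<in> space \<nu>"
    and fin: "\<And>m T. 0 < m \<Longrightarrow> (\<And>j. T j \<in> V) \<Longrightarrow>
      (\<integral>\<^sup>+x. upow \<alpha> ((\<Sum>j<m. l (T j) x) / of_nat m) * neg_pow \<alpha> (l b x) \<partial>M) \<le> \<rho>"
    and "f \<in> borel_measurable \<nu>"
    and "\<And>t. t \<in> space \<nu> \<Longrightarrow> t \<notin> V \<Longrightarrow> f t = 0" "(\<integral>\<^sup>+t. f t \<partial>\<nu>) < \<top>"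
  shows "(\<integral>\<^sup>+\<omega>. upow \<alpha> (\<integral>\<^sup>+t. f t * lik n \<omega> t \<partial>\<nu>) * neg_pow \<alpha> (lik n \<omega> b) \<partial>S)
    \<le> \<rho> ^ n * upow \<alpha> (\<integral>\<^sup>+t. f t \<partial>\<nu>)"
  using assms(4-6)
proof (induction n arbitrary: f)
  case 0
  interpret S: sequence_space M ..
  show ?case by (simp add: S.emeasure_space_1)
next
  case (Suc n)
  note [measurable] = Suc.prems(1)
  interpret S: sequence_space M ..
  have "(\<integral>\<^sup>+\<omega>. upow \<alpha> (\<integral>\<^sup>+t. f t * lik (Suc n) \<omega> t \<partial>\<nu>) * neg_pow \<alpha> (lik (Suc n) \<omega> b) \<partial>S)
    = (\<integral>\<^sup>+x. \<integral>\<^sup>+\<omega>. upow \<alpha> (\<integral>\<^sup>+t. f t * lik (Suc n) (case_nat x \<omega>) t \<partial>\<nu>) *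
         neg_pow \<alpha> (lik (Suc n) (case_nat x \<omega>) b) \<partial>S \<partial>M)"
    by (rule nn_integral_S_Suc) measurable
  also have "\<dots> = (\<integral>\<^sup>+x. neg_pow \<alpha> (l b x) * (\<integral>\<^sup>+\<omega>. upow \<alpha> (\<integral>\<^sup>+t. (f t * l t x) * lik n \<omega> t \<partial>\<nu>) *
         neg_pow \<alpha> (lik n \<omega> b) \<partial>S) \<partial>M)"
  proof (intro nn_integral_cong)
    fix x assume [measurable]: "x \<in> space M"
    have "(\<integral>\<^sup>+\<omega>. upow \<alpha> (\<integral>\<^sup>+t. f t * lik (Suc n) (case_nat x \<omega>) t \<partial>\<nu>) *
         neg_pow \<alpha> (lik (Suc n) (case_nat x \<omega>) b) \<partial>S) =
      (\<integral>\<^sup>+\<omega>. neg_pow \<alpha> (l b x) * (upow \<alpha> (\<integral>\<^sup>+t. (f t * l t x) * lik n \<omega> t \<partial>\<nu>) *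
         neg_pow \<alpha> (lik n \<omega> b)) \<partial>S)"
      by (simp add: lik_Suc neg_pow_mult \<alpha> l_finite lik_finite ac_simps)
    also have "\<dots> = neg_pow \<alpha> (l b x) * (\<integral>\<^sup>+\<omega>. upow \<alpha> (\<integral>\<^sup>+t. (f t * l t x) * lik n \<omega> t \<partial>\<nu>) *
         neg_pow \<alpha> (lik n \<omega> b) \<partial>S)"
      by (rule nn_integral_cmult) measurable
    finally show "(\<integral>\<^sup>+\<omega>. upow \<alpha> (\<integral>\<^sup>+t. f t * lik (Suc n) (case_nat x \<omega>) t \<partial>\<nu>) *
         neg_pow \<alpha> (lik (Suc n) (case_nat x \<omega>) b) \<partial>S) = neg_pow \<alpha> (l b x) *
         (\<integral>\<^sup>+\<omega>. upow \<alpha> (\<integral>\<^sup>+t. (f t * l t x) * lik n \<omega> t \<partial>\<nu>) * neg_pow \<alpha> (lik n \<omega> b) \<partial>S)" .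
  qed
  also have "\<dots> \<le> (\<integral>\<^sup>+x. neg_pow \<alpha> (l b x) * (\<rho> ^ n * upow \<alpha> (\<integral>\<^sup>+t. f t * l t x \<partial>\<nu>)) \<partial>M)"
  proof (rule nn_integral_mono_AE)
    \<comment> \<open>The induction hypothesis requires a weight of finite mass, which holds for
      almost every \<open>x\<close> only.\<close>
    show "AE x in M. neg_pow \<alpha> (l b x) * (\<integral>\<^sup>+\<omega>. upow \<alpha> (\<integral>\<^sup>+t. (f t * l t x) * lik n \<omega> t \<partial>\<nu>) *
         neg_pow \<alpha> (lik n \<omega> b) \<partial>S) \<le> neg_pow \<alpha> (l b x) * (\<rho> ^ n * upow \<alpha> (\<integral>\<^sup>+t. f t * l t x \<partial>\<nu>))"
      using AE_mixture_finite[OF Suc.prems(1,3)] AE_space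
    proof eventually_elim
      case (elim x)
      note [measurable] = elim(2)
      show ?case
        using Suc.prems(2) elim(1) by (intro mult_left_mono Suc.IH) auto
    qed
  qed
  also have "\<dots> = \<rho> ^ n * (\<integral>\<^sup>+x. upow \<alpha> (\<integral>\<^sup>+t. f t * l t x \<partial>\<nu>) * neg_pow \<alpha> (l b x) \<partial>M)"
    by (subst nn_integral_cmult [symmetric]) (auto simp: ac_simps)
  \<comment> \<open>The remaining integral over \<open>x\<close> is a one-observation moment of a
    weighted mixture and supplies the last factor \<rho>.\<close>
  also have "\<dots> \<le> \<rho> ^ n * (\<rho> * upow \<alpha> (\<integral>\<^sup>+t. f t \<partial>\<nu>))"
    using Suc.prems
    by (intro mult_left_mono truth.weighted_mixture_moment_le[OF prior.prob_space_axioms, where V = V] fin \<alpha>)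
      auto
  finally show ?case by (simp add: ac_simps)
qed

end

section \<open>Summable moments and almost sure convergence\<close>

lemma ennreal_suminf_finite_tendsto_0:
  fixes f :: "nat \<Rightarrow> ennreal"
  assumes "(\<Sum>n. f n) < \<top>"
  shows "f \<longlonglongrightarrow> 0"
proof -
  have f: "f n = ennreal (enn2real (f n))" for n
    using ennreal_suminf_lessD[OF assms, of n] by simp
  have "summable (\<lambda>n. enn2real (f n))"
    using assms by (intro summable_suminf_not_top) (auto simp: f[symmetric])
  then have "(\<lambda>n. ennreal (enn2real (f n))) \<longlonglongrightarrow> ennreal 0"
    by (intro tendsto_ennrealI summable_LIMSEQ_zero)
  then show ?thesis by (simp add: f[symmetric])
qed

lemma ennreal_suminf_geometric_finite:
  fixes \<rho> :: ennreal
  assumes "\<rho> < 1"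
  shows "(\<Sum>n. \<rho> ^ n) < \<top>"
proof -
  obtain r where r: "\<rho> = ennreal r" "0 \<le> r" "r < 1"
    using assms by (cases \<rho>) auto
  have "(\<Sum>n. ennreal (r ^ n)) \<noteq> \<top>"
    using r by (intro ennreal_suminf_neq_top summable_geometric) auto
  then show ?thesis
    using r by (simp add: ennreal_power less_top)
qed

context likelihood_model
begin

text \<open>\<open>U\<close> is the prior conditioned on \<open>B\<close>, and the quotient by
  \<open>emeasure \<nu> B\<close> is the mean of the likelihood under \<open>U\<close>. Jensen moves
  the negative power inside this mean; after Fubini each fixed \<open>b\<close> in \<open>B\<close>
  is covered by the power bound.\<close>

lemma Jensen_moment_le_power:
  assumes \<alpha>: "0 \<le> \<alpha>" and [measurable]: "V \<in> sets \<nu>" "B \<in> sets \<nu>" and B: "0 < emeasure \<nu> B"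
    and fin: "\<And>m T b. 0 < m \<Longrightarrow> (\<And>j. T j \<in> V) \<Longrightarrow> b \<in> B \<Longrightarrow>
      (\<integral>\<^sup>+x. upow \<alpha> ((\<Sum>j<m. l (T j) x) / of_nat m) * neg_pow \<alpha> (l b x) \<partial>M) \<le> \<rho>"
  shows "(\<integral>\<^sup>+\<omega>. upow \<alpha> (\<integral>\<^sup>+t\<in>V. lik n \<omega> t \<partial>\<nu>) *
      neg_pow \<alpha> ((\<integral>\<^sup>+t\<in>B. lik n \<omega> t \<partial>\<nu>) / emeasure \<nu> B) \<partial>S) \<le> \<rho> ^ n"
proof -
  define U where "U = uniform_measure \<nu> B"
  have [measurable_cong]: "sets U = sets \<nu>"
    by (simp add: U_def)
  interpret U: prob_space U
    unfolding U_def using B by (intro prob_space_uniform_measure) (auto simp: prior.emeasure_eq_measure)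
  interpret S: sequence_space M ..
  interpret SU: pair_sigma_finite S U ..
  have "(\<integral>\<^sup>+\<omega>. upow \<alpha> (\<integral>\<^sup>+t\<in>V. lik n \<omega> t \<partial>\<nu>) *
      neg_pow \<alpha> ((\<integral>\<^sup>+t\<in>B. lik n \<omega> t \<partial>\<nu>) / emeasure \<nu> B) \<partial>S)
    = (\<integral>\<^sup>+\<omega>. upow \<alpha> (\<integral>\<^sup>+t\<in>V. lik n \<omega> t \<partial>\<nu>) * neg_pow \<alpha> (\<integral>\<^sup>+b. lik n \<omega> b \<partial>U) \<partial>S)"
  proof (intro nn_integral_cong)
    fix \<omega> assume [measurable]: "\<omega> \<in> space S"
    show "upow \<alpha> (\<integral>\<^sup>+t\<in>V. lik n \<omega> t \<partial>\<nu>) * neg_pow \<alpha> ((\<integral>\<^sup>+t\<in>B. lik n \<omega> t \<partial>\<nu>) / emeasure \<nu> B)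
      = upow \<alpha> (\<integral>\<^sup>+t\<in>V. lik n \<omega> t \<partial>\<nu>) * neg_pow \<alpha> (\<integral>\<^sup>+b. lik n \<omega> b \<partial>U)"
      unfolding U_def by (subst nn_integral_uniform_measure) auto
  qed
  also have "\<dots> \<le> (\<integral>\<^sup>+\<omega>. upow \<alpha> (\<integral>\<^sup>+t\<in>V. lik n \<omega> t \<partial>\<nu>) * (\<integral>\<^sup>+b. neg_pow \<alpha> (lik n \<omega> b) \<partial>U) \<partial>S)"
    by (intro nn_integral_mono mult_left_mono U.neg_pow_jensen \<alpha>) auto
  also have "\<dots> = (\<integral>\<^sup>+\<omega>. \<integral>\<^sup>+b. upow \<alpha> (\<integral>\<^sup>+t\<in>V. lik n \<omega> t \<partial>\<nu>) * neg_pow \<alpha> (lik n \<omega> b) \<partial>U \<partial>S)"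
    by (intro nn_integral_cong nn_integral_cmult [symmetric]) measurable
  also have "\<dots> = (\<integral>\<^sup>+b. \<integral>\<^sup>+\<omega>. upow \<alpha> (\<integral>\<^sup>+t\<in>V. lik n \<omega> t \<partial>\<nu>) * neg_pow \<alpha> (lik n \<omega> b) \<partial>S \<partial>U)"
    by (rule SU.Fubini' [symmetric]) measurable
  also have "\<dots> \<le> (\<integral>\<^sup>+b. \<rho> ^ n \<partial>U)"
  proof (rule nn_integral_mono_AE)
    have le: "(\<integral>\<^sup>+\<omega>. upow \<alpha> (\<integral>\<^sup>+t\<in>V. lik n \<omega> t \<partial>\<nu>) * neg_pow \<alpha> (lik n \<omega> b) \<partial>S) \<le> \<rho> ^ n"
      if b: "b \<in> B" for b
    proof -
      have V1: "emeasure \<nu> V \<le> 1"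
        by (rule prior.measure_le_1)
      have "b \<in> space \<nu>"
        using b sets.sets_into_space[OF \<open>B \<in> sets \<nu>\<close>] by auto
      \<comment> \<open>The induction starts from the weight \<open>indicator V\<close>, whose mass
        is at most 1.\<close>
      have "(\<integral>\<^sup>+\<omega>. upow \<alpha> (\<integral>\<^sup>+t\<in>V. lik n \<omega> t \<partial>\<nu>) * neg_pow \<alpha> (lik n \<omega> b) \<partial>S)
        = (\<integral>\<^sup>+\<omega>. upow \<alpha> (\<integral>\<^sup>+t. indicator V t * lik n \<omega> t \<partial>\<nu>) * neg_pow \<alpha> (lik n \<omega> b) \<partial>S)"
        by (simp add: mult.commute)
      also have "\<dots> \<le> \<rho> ^ n * upow \<alpha> (\<integral>\<^sup>+t. indicator V t \<partial>\<nu>)"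
        using V1 b by (intro moment_le_power[where V = V] \<alpha> fin \<open>b \<in> space \<nu>\<close>)
          (auto intro: le_less_trans)
      also have "\<dots> \<le> \<rho> ^ n * upow \<alpha> 1"
        using V1 by (intro mult_left_mono upow_mono \<alpha>) auto
      finally show ?thesis by simp
    qed
    show "AE b in U. (\<integral>\<^sup>+\<omega>. upow \<alpha> (\<integral>\<^sup>+t\<in>V. lik n \<omega> t \<partial>\<nu>) * neg_pow \<alpha> (lik n \<omega> b) \<partial>S) \<le> \<rho> ^ n"
      unfolding U_def by (intro AE_uniform_measureI AE_I2 impI le) measurable
  qed
  finally show ?thesis by (simp add: U.emeasure_space_1)
qed

text \<open>The moments of \<open>W n\<close> are dominated by a geometric series, so the sum of the
  \<open>W n\<close> is almost surely finite and \<open>W n\<close> tends to 0. The full denominator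
  \<open>D n\<close> is at least its part over \<open>B\<close>, so a ratio staying away from 0
  would keep \<open>W n\<close> away from 0.\<close>

theorem AE_likelihood_ratio_tendsto_0:
  assumes \<alpha>: "0 \<le> \<alpha>" and [measurable]: "V \<in> sets \<nu>" "B \<in> sets \<nu>" and B: "0 < emeasure \<nu> B"
    and fin: "\<And>m T b. 0 < m \<Longrightarrow> (\<And>j. T j \<in> V) \<Longrightarrow> b \<in> B \<Longrightarrow>
      (\<integral>\<^sup>+x. upow \<alpha> ((\<Sum>j<m. l (T j) x) / of_nat m) * neg_pow \<alpha> (l b x) \<partial>M) \<le> \<rho>"
    and \<rho>: "\<rho> < 1"
  shows "AE \<omega> in S. (\<lambda>n. (\<integral>\<^sup>+t\<in>V. lik n \<omega> t \<partial>\<nu>) / (\<integral>\<^sup>+t. lik n \<omega> t \<partial>\<nu>)) \<longlonglongrightarrow> 0"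
proof -
  define \<beta> where "\<beta> = emeasure \<nu> B"
  have \<beta>: "0 < \<beta>" "\<beta> < \<top>"
    using B by (auto simp: \<beta>_def prior.emeasure_eq_measure)
  have inv\<beta>: "inverse \<beta> < \<top>"
    using \<beta> by (simp add: less_top [symmetric])
  define W where "W n \<omega> = upow \<alpha> (\<integral>\<^sup>+t\<in>V. lik n \<omega> t \<partial>\<nu>) *
    neg_pow \<alpha> ((\<integral>\<^sup>+t\<in>B. lik n \<omega> t \<partial>\<nu>) / \<beta>)" for n \<omega>
  have [measurable]: "W n \<in> borel_measurable S" for n
    unfolding W_def by measurable
  have "(\<integral>\<^sup>+\<omega>. (\<Sum>n. W n \<omega>) \<partial>S) = (\<Sum>n. \<integral>\<^sup>+\<omega>. W n \<omega> \<partial>S)"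
    by (rule nn_integral_suminf) measurable
  also have "\<dots> \<le> (\<Sum>n. \<rho> ^ n)"
    unfolding W_def \<beta>_def
    by (intro suminf_le Jensen_moment_le_power \<alpha> B fin) auto
  also have "\<dots> < \<top>"
    by (rule ennreal_suminf_geometric_finite[OF \<rho>])
  finally have "AE \<omega> in S. (\<Sum>n. W n \<omega>) \<noteq> \<infinity>"
    by (intro nn_integral_PInf_AE) auto
  with AE_space show ?thesis
  proof eventually_elim
    case (elim \<omega>)
    note [measurable] = elim(1)
    have W: "(\<lambda>n. W n \<omega>) \<longlonglongrightarrow> 0"
      using elim by (intro ennreal_suminf_finite_tendsto_0) (simp add: less_top [symmetric])
    define Z where "Z n = (\<integral>\<^sup>+t\<in>V. lik n \<omega> t \<partial>\<nu>)" for n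
    define D where "D n = (\<integral>\<^sup>+t. lik n \<omega> t \<partial>\<nu>)" for n
    have Z_le: "Z n \<le> D n" for n
      unfolding Z_def D_def by (intro nn_integral_mono) (auto split: split_indicator)
    have B_le: "(\<integral>\<^sup>+t\<in>B. lik n \<omega> t \<partial>\<nu>) \<le> D n" for n
      unfolding D_def by (intro nn_integral_mono) (auto split: split_indicator)
    \<comment> \<open>The lower bound on \<open>W n \<omega>\<close> does not depend on
      \<open>n\<close>; for \<alpha> > 0 and finite \<open>e\<close> it is the \<alpha>-th power of
      \<open>e * \<beta>\<close>.\<close>
    have W_ge: "upow \<alpha> e * neg_pow \<alpha> (inverse \<beta>) \<le> W n \<omega>" if e: "0 < e" "e \<le> Z n / D n" for e n
    proof -
      \<comment> \<open>If \<open>D n\<close> is 0 then so is \<open>Z n\<close>, and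
        \<open>0 / 0 = 0\<close>; if \<open>D n\<close> is \<open>\<top>\<close> the quotient is 0
        as well. Both contradict a ratio of at least \<open>e > 0\<close>.\<close>
      have D: "0 < D n" "D n < \<top>"
        using e Z_le[of n] by (auto simp: zero_less_iff_neq_zero less_top [symmetric])
      \<comment> \<open>The inserted factor 1 is split between numerator and denominator:
        \<open>e * D n\<close> is compared with \<open>Z n\<close>, and
        \<open>D n * inverse \<beta>\<close> with the prior average over \<open>B\<close>.\<close>
      have "upow \<alpha> e * neg_pow \<alpha> (inverse \<beta>)
          = upow \<alpha> e * neg_pow \<alpha> (inverse \<beta>) * (upow \<alpha> (D n) * neg_pow \<alpha> (D n))"
        by (simp add: upow_mult_neg_pow[OF \<alpha> D])
      also have "\<dots> = upow \<alpha> (e * D n) * neg_pow \<alpha> (D n * inverse \<beta>)"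
        by (simp add: upow_mult \<alpha> neg_pow_mult inv\<beta> D ac_simps)
      also have "\<dots> \<le> upow \<alpha> (Z n) * neg_pow \<alpha> ((\<integral>\<^sup>+t\<in>B. lik n \<omega> t \<partial>\<nu>) / \<beta>)"
      proof (intro mult_mono upow_mono neg_pow_antimono \<alpha>)
        have "e * D n \<le> Z n / D n * D n"
          using e by (intro mult_right_mono) auto
        also have "\<dots> = Z n"
          using D by (simp add: ennreal_divide_times ennreal_mult_divide_eq)
        finally show "e * D n \<le> Z n" .
        show "(\<integral>\<^sup>+t\<in>B. lik n \<omega> t \<partial>\<nu>) / \<beta> \<le> D n * inverse \<beta>"
          unfolding divide_ennreal_def by (intro mult_right_mono B_le) auto
      qed auto
      finally show ?thesis by (simp add: W_def Z_def)
    qed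
    have "(\<lambda>n. Z n / D n) \<longlonglongrightarrow> 0"
    proof (rule order_tendstoI)
      fix e :: ennreal assume e: "0 < e"
      have "0 < upow \<alpha> e * neg_pow \<alpha> (inverse \<beta>)"
        using upow_pos[OF e] neg_pow_pos[OF \<alpha> inv\<beta>] by (simp add: ennreal_zero_less_mult_iff)
      then have "\<forall>\<^sub>F n in sequentially. W n \<omega> < upow \<alpha> e * neg_pow \<alpha> (inverse \<beta>)"
        by (rule order_tendstoD(2)[OF W])
      then show "\<forall>\<^sub>F n in sequentially. Z n / D n < e"
        by eventually_elim (meson W_ge e not_le)
    qed simp
    then show ?case by (simp add: Z_def D_def)
  qed
qed

end

subsection \<open>Densities and convex hulls\<close>

text \<open>This matches the product of powers with the conventions for
  \<open>P0 (dP/dQ)^\<alpha>\<close>: \<open>upow\<close> removes the points with vanishing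
  numerator for every \<alpha>, and for \<alpha> > 0 \<open>neg_pow\<close> is infinite where the
  denominator vanishes.\<close>

lemma upow_mult_neg_pow_eq_ratio_powr:
  assumes "0 \<le> \<alpha>" "0 \<le> a" "0 \<le> q"
  shows "upow \<alpha> (ennreal a) * neg_pow \<alpha> (ennreal q) = (if 0 < a then ratio_powr \<alpha> a q else 0)"
proof (cases "0 < a \<and> \<alpha> \<noteq> 0 \<and> q \<noteq> 0")
  case True
  with assms show ?thesis
    by (simp add: neg_pow_def upow_ennreal ratio_powr_def inverse_ennreal powr_divide
        ennreal_mult' [symmetric] field_simps)
next
  case False
  with assms show ?thesis
    by (auto simp: neg_pow_def upow_ennreal ratio_powr_def ennreal_mult_top)
qed

lemma (in sigma_finite_measure) AE_dens_density:
  assumes [measurable]: "f \<in> borel_measurable M" and f: "\<And>x. x \<in> space M \<Longrightarrow> 0 \<le> f x"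
  shows "AE x in M. dens M (density M (\<lambda>x. ennreal (f x))) x = f x"
proof -
  have "AE x in M. ennreal (f x) = RN_deriv M (density M (\<lambda>x. ennreal (f x))) x"
    by (rule RN_deriv_unique) auto
  then show ?thesis
    using AE_space by eventually_elim (metis dens_def enn2real_ennreal f)
qed

text \<open>Radon-Nikodym derivatives agree with the given densities off a null set. The restriction
  to a positive true density disappears because the integral is taken against the true distribution,
  and the restriction to a positive numerator is built into \<open>upow\<close>.\<close>

lemma (in sigma_finite_measure) ratio_moment_density:
  assumes [measurable]: "f0 \<in> borel_measurable M" "f \<in> borel_measurable M" "q \<in> borel_measurable M"
    and nonneg: "\<And>x. x \<in> space M \<Longrightarrow> 0 \<le> f0 x" "\<And>x. x \<in> space M \<Longrightarrow> 0 \<le> f x"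
      "\<And>x. x \<in> space M \<Longrightarrow> 0 \<le> q x"
    and \<alpha>: "0 \<le> \<alpha>"
  shows "ratio_moment M (density M (\<lambda>x. ennreal (f0 x))) \<alpha>
      (density M (\<lambda>x. ennreal (f x))) (density M (\<lambda>x. ennreal (q x)))
    = (\<integral>\<^sup>+x. upow \<alpha> (ennreal (f x)) * neg_pow \<alpha> (ennreal (q x)) \<partial>density M (\<lambda>x. ennreal (f0 x)))"
proof -
  have dens: "AE x in M. dens M (density M (\<lambda>x. ennreal (f0 x))) x = f0 x"
    "AE x in M. dens M (density M (\<lambda>x. ennreal (f x))) x = f x"
    "AE x in M. dens M (density M (\<lambda>x. ennreal (q x))) x = q x"
    by (intro AE_dens_density; simp add: nonneg)+
  show ?thesis
    unfolding ratio_moment_def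
  proof (rule nn_integral_cong_AE, subst AE_density)
    show "AE x in M. 0 < ennreal (f0 x) \<longrightarrow>
        ratio_powr \<alpha> (dens M (density M (\<lambda>x. ennreal (f x))) x) (dens M (density M (\<lambda>x. ennreal (q x))) x) *
        indicator {x \<in> space M. 0 < dens M (density M (\<lambda>x. ennreal (f0 x))) x \<and>
          0 < dens M (density M (\<lambda>x. ennreal (f x))) x} x =
        upow \<alpha> (ennreal (f x)) * neg_pow \<alpha> (ennreal (q x))"
      using dens AE_space
    proof eventually_elim
      case (elim x)
      then show ?case
        using nonneg[OF elim(4)]
        by (simp add: upow_mult_neg_pow_eq_ratio_powr[OF \<alpha>] indicator_def)
    qed
  qed measurable
qed

text \<open>Equal weights \<open>1 / m\<close> suffice, because the mixtures that arise from
  sampling are averages, possibly with repeated members.\<close>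

lemma average_density_in_measure_co:
  assumes [measurable]: "\<And>j. f j \<in> borel_measurable \<mu>"
    and nonneg: "\<And>j x. x \<in> space \<mu> \<Longrightarrow> 0 \<le> f j x"
    and V: "\<And>j. density \<mu> (\<lambda>x. ennreal (f j x)) \<in> V" and m: "0 < m"
  shows "density \<mu> (\<lambda>x. ennreal ((\<Sum>j<m. f j x) / real m)) \<in> measure_co V"
proof -
  let ?M = "density \<mu> (\<lambda>x. ennreal ((\<Sum>j<m. f j x) / real m))"
  let ?Q = "\<lambda>j. density \<mu> (\<lambda>x. ennreal (f j x))"
  have "emeasure ?M A = (\<Sum>j<m. ennreal (1 / real m) * emeasure (?Q j) A)"
    if A [measurable]: "A \<in> sets \<mu>" for A
  proof -
    have "emeasure ?M A = (\<integral>\<^sup>+x. (\<Sum>j<m. ennreal (1 / real m) * (ennreal (f j x) * indicator A x)) \<partial>\<mu>)"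
    proof (subst emeasure_density)
      show "(\<integral>\<^sup>+x\<in>A. ennreal ((\<Sum>j<m. f j x) / real m) \<partial>\<mu>) =
          (\<integral>\<^sup>+x. (\<Sum>j<m. ennreal (1 / real m) * (ennreal (f j x) * indicator A x)) \<partial>\<mu>)"
      proof (intro nn_integral_cong)
        fix x assume "x \<in> space \<mu>"
        have "ennreal ((\<Sum>j<m. f j x) / real m) = (\<Sum>j<m. ennreal (1 / real m) * ennreal (f j x))"
          using nonneg[OF \<open>x \<in> space \<mu>\<close>]
          by (simp add: sum_divide_distrib ennreal_mult' [symmetric])
        then show "ennreal ((\<Sum>j<m. f j x) / real m) * indicator A x =
            (\<Sum>j<m. ennreal (1 / real m) * (ennreal (f j x) * indicator A x))"
          by (simp add: sum_distrib_right mult.assoc)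
      qed
    qed auto
    also have "\<dots> = (\<Sum>j<m. ennreal (1 / real m) * emeasure (?Q j) A)"
      by (simp add: nn_integral_sum nn_integral_cmult emeasure_density)
    finally show ?thesis .
  qed
  then show ?thesis
    unfolding measure_co_def using V m
    by (intro CollectI exI[of _ m] exI[of _ "\<lambda>_. 1 / real m"] exI[of _ ?Q]) auto
qed

section \<open>From the cover of the far set to posterior convergence\<close>

theorem theorem6p1:
  fixes \<Theta> :: "(real ^ 'k) set"
    and H :: "'h measure"
    and \<mu> :: "'x measure"
    and P :: "(real ^ 'k) \<times> 'h \<Rightarrow> 'x measure"
    and p :: "(real ^ 'k) \<times> 'h \<Rightarrow> 'x \<Rightarrow> real"
    and prior :: "((real ^ 'k) \<times> 'h) measure"
    and g :: "real ^ 'k \<Rightarrow> real ^ 'k \<Rightarrow> real"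
    and \<theta>0 :: "real ^ 'k" and \<eta>0 :: 'h and P0 :: "'x measure"
  assumes "open \<Theta>"
    and "sigma_finite_measure \<mu>"
    and "P \<in> restrict_space borel \<Theta> \<Otimes>\<^sub>M H \<rightarrow>\<^sub>M prob_algebra \<mu>"
    and "case_prod p \<in> borel_measurable ((restrict_space borel \<Theta> \<Otimes>\<^sub>M H) \<Otimes>\<^sub>M \<mu>)"
    and "\<And>t x. t \<in> \<Theta> \<times> space H \<Longrightarrow> x \<in> space \<mu> \<Longrightarrow> 0 \<le> p t x"
    and "\<And>t. t \<in> \<Theta> \<times> space H \<Longrightarrow> P t = density \<mu> (\<lambda>x. ennreal (p t x))"
    and "prob_space prior"
    and "sets prior = sets (restrict_space borel \<Theta> \<Otimes>\<^sub>M H)"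
    and "\<theta>0 \<in> \<Theta>" and "\<eta>0 \<in> space H" and "P0 = P (\<theta>0, \<eta>0)"
    and "in_hellinger_support \<mu> P prior P0"
    and "Metric_space \<Theta> g"
    and "\<And>\<epsilon>. \<epsilon> > 0 \<Longrightarrow> marginal_far_set \<Theta> H P g \<theta>0 \<epsilon> \<in> model_events P prior"
    and "\<And>\<epsilon>. \<epsilon> > 0 \<Longrightarrow>
          \<exists>(N::nat) V B.
            marginal_far_set \<Theta> H P g \<theta>0 \<epsilon> \<subseteq> (\<Union>i\<in>{1..N}. V i) \<and>
            (\<forall>i\<in>{1..N}.
               V i \<in> model_events P prior \<and>
               B i \<in> model_events P prior \<and>
               testing_pi \<mu> P0 (measure_co (V i)) (B i) < 1 \<and>
               prior_prob P prior (B i) > 0 \<and>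
               (\<forall>Q'\<in>V i. (SUP Q\<in>B i. ratio_moment \<mu> P0 1 Q' Q) < \<infinity>))"
  shows "\<forall>\<epsilon>>0. AE x in (\<Pi>\<^sub>M i\<in>(UNIV::nat set). P0).
           (\<lambda>n. posterior P p prior n x (marginal_far_set \<Theta> H P g \<theta>0 \<epsilon>)) \<longlonglongrightarrow> 0"
proof (intro allI impI)
  fix \<epsilon> :: real assume \<epsilon>: "0 < \<epsilon>"
  interpret dom: sigma_finite_measure \<mu> by (fact assms(2))
  have space_prior: "space prior = \<Theta> \<times> space H"
    using sets_eq_imp_space_eq[OF assms(8)] by (simp add: space_pair_measure space_restrict_space)
  define l where "l t x = ennreal (p t x)" for t x
  have p [measurable]: "case_prod p \<in> borel_measurable (prior \<Otimes>\<^sub>M \<mu>)"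
    using assms(4) by (simp cong: measurable_cong_sets add: sets_pair_measure_cong[OF assms(8) refl])
  have P: "P t = density \<mu> (\<lambda>x. ennreal (p t x))" if "t \<in> space prior" for t
    using assms(6) that by (simp add: space_prior)
  have prob_P: "prob_space (P t)" if "t \<in> space prior" for t
    using measurable_space[OF assms(3), of t] that
    by (simp add: space_prior space_prob_algebra space_pair_measure space_restrict_space)
  have p_nonneg: "0 \<le> p t x" if "t \<in> space prior" "x \<in> space \<mu>" for t x
    using assms(5) that by (simp add: space_prior)
  have t0: "(\<theta>0, \<eta>0) \<in> space prior"
    using assms(9,10) by (simp add: space_prior)
  interpret likelihood_model prior P0 \<mu> l
  proof (intro likelihood_model.intro likelihood_model_axioms.intro)
    show "prob_space prior" "sigma_finite_measure \<mu>" by fact+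
    show "prob_space P0" using prob_P[OF t0] assms(11) by simp
    show "sets P0 = sets \<mu>" using P[OF t0] assms(11) by simp
    show "absolutely_continuous \<mu> P0"
      using t0 by (simp add: P assms(11) absolutely_continuousI_density)
    show "case_prod l \<in> borel_measurable (prior \<Otimes>\<^sub>M \<mu>)"
      unfolding l_def[abs_def] by measurable
    \<comment> \<open>Densities are real-valued, so finiteness holds at every point, also for
      \<open>t\<close> outside the parameter space.\<close>
    show "l t x < \<top>" for t x
      by (simp add: l_def)
    fix t assume t [measurable]: "t \<in> space prior"
    have "(\<integral>\<^sup>+x. l t x \<partial>\<mu>) = emeasure (P t) (space (P t))"
      by (auto simp: P[OF t] l_def emeasure_density intro!: nn_integral_cong)
    then show "(\<integral>\<^sup>+x. l t x \<partial>\<mu>) = 1"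
      using prob_space.emeasure_space_1[OF prob_P[OF t]] by simp
  qed
  let ?F = "marginal_far_set \<Theta> H P g \<theta>0 \<epsilon>"
  have posterior: "posterior P p prior n x A =
      (\<integral>\<^sup>+t\<in>(P -` A \<inter> space prior). lik n x t \<partial>prior) / (\<integral>\<^sup>+t. lik n x t \<partial>prior)" for n x A
    by (simp add: posterior_def lik_def l_def)
  obtain N :: nat and V B where cover: "?F \<subseteq> (\<Union>i\<in>{1..N}. V i)"
    and VB: "\<And>i. i \<in> {1..N} \<Longrightarrow> V i \<in> model_events P prior"
      "\<And>i. i \<in> {1..N} \<Longrightarrow> B i \<in> model_events P prior"
      "\<And>i. i \<in> {1..N} \<Longrightarrow> testing_pi \<mu> P0 (measure_co (V i)) (B i) < 1"
      "\<And>i. i \<in> {1..N} \<Longrightarrow> prior_prob P prior (B i) > 0"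
    using assms(15)[OF \<epsilon>] by metis
  have "AE x in S. (\<lambda>n. posterior P p prior n x (V i)) \<longlonglongrightarrow> 0" if i: "i \<in> {1..N}" for i
  proof -
    let ?V = "P -` V i \<inter> space prior" and ?B = "P -` B i \<inter> space prior"
    \<comment> \<open>An infimum below 1 is undercut by a single exponent; its supremum of moments
      over the hull and \<open>B i\<close> then serves as \<rho>.\<close>
    obtain \<alpha> where \<alpha>: "\<alpha> \<in> {0..1}"
      and less: "(SUP P\<in>measure_co (V i). SUP Q\<in>B i. ratio_moment \<mu> P0 \<alpha> P Q) < 1"
      using VB(3)[OF i] unfolding testing_pi_def INF_less_iff by auto
    show ?thesis
      unfolding posterior
    proof (rule AE_likelihood_ratio_tendsto_0[OF _ _ _ _ _ less])
      show "0 \<le> \<alpha>" using \<alpha> by simp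
      show "?V \<in> sets prior" "?B \<in> sets prior"
        using VB(1,2)[OF i] by (auto simp: model_events_def)
      show "0 < emeasure prior ?B"
        using VB(4)[OF i] by (simp add: prior_prob_def prior.emeasure_eq_measure)
      fix m :: nat and T :: "nat \<Rightarrow> (real ^ 'k) \<times> 'h" and b
      assume m: "0 < m" and T: "\<And>j. T j \<in> ?V" and b: "b \<in> ?B"
      have [measurable]: "T j \<in> space prior" "b \<in> space prior" for j
        using T[of j] b by auto
      have T_nonneg: "0 \<le> p (T j) x" if "x \<in> space \<mu>" for x j
        using T[of j] that by (intro p_nonneg) auto
      let ?f = "\<lambda>x. (\<Sum>j<m. p (T j) x) / real m"
      have "(\<integral>\<^sup>+x. upow \<alpha> ((\<Sum>j<m. l (T j) x) / of_nat m) * neg_pow \<alpha> (l b x) \<partial>P0)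
        = (\<integral>\<^sup>+x. upow \<alpha> (ennreal (?f x)) * neg_pow \<alpha> (ennreal (p b x)) \<partial>P0)"
        using m T_nonneg
        by (intro nn_integral_cong) (simp add: l_def space_M divide_ennreal [symmetric] sum_nonneg
            sum_ennreal ennreal_of_nat_eq_real_of_nat)
      also have "\<dots> = ratio_moment \<mu> P0 \<alpha> (density \<mu> (\<lambda>x. ennreal (?f x))) (P b)"
        using t0 b T_nonneg \<alpha>
        by (simp add: P assms(11), subst dom.ratio_moment_density)
          (auto intro!: p_nonneg[OF t0] p_nonneg[of b] sum_nonneg divide_nonneg_nonneg)
      \<comment> \<open>The averaged density belongs to a member of the convex hull of
        \<open>V i\<close> and \<open>P b\<close> lies in \<open>B i\<close>, so this moment is
        among those in the supremum.\<close>
      also have "\<dots> \<le> (SUP P\<in>measure_co (V i). SUP Q\<in>B i. ratio_moment \<mu> P0 \<alpha> P Q)"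
      proof (rule SUP_upper2, rule average_density_in_measure_co[OF _ _ _ m])
        show "density \<mu> (\<lambda>x. ennreal (p (T j) x)) \<in> V i" for j
          using T[of j] P[of "T j"] by auto
        show "ratio_moment \<mu> P0 \<alpha> (density \<mu> (\<lambda>x. ennreal (?f x))) (P b)
            \<le> (SUP Q\<in>B i. ratio_moment \<mu> P0 \<alpha> (density \<mu> (\<lambda>x. ennreal (?f x))) Q)"
          using b by (intro SUP_upper) auto
      qed (use T_nonneg in auto)
      finally show "(\<integral>\<^sup>+x. upow \<alpha> ((\<Sum>j<m. l (T j) x) / of_nat m) * neg_pow \<alpha> (l b x) \<partial>P0)
          \<le> (SUP P\<in>measure_co (V i). SUP Q\<in>B i. ratio_moment \<mu> P0 \<alpha> P Q)" .
    qed
  qed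
  then have "AE x in S. \<forall>i\<in>{1..N}. (\<lambda>n. posterior P p prior n x (V i)) \<longlonglongrightarrow> 0"
    by (intro AE_finite_allI) auto
  with AE_space show "AE x in S. (\<lambda>n. posterior P p prior n x ?F) \<longlonglongrightarrow> 0"
  proof eventually_elim
    case (elim x)
    note [measurable] = elim(1)
    \<comment> \<open>Union bound over the cover: the numerators are subadditive, and all the
      posteriors share one denominator.\<close>
    have le: "posterior P p prior n x ?F \<le> (\<Sum>i\<in>{1..N}. posterior P p prior n x (V i))" for n
    proof -
      have [measurable]: "P -` V i \<inter> space prior \<in> sets prior" if "i \<in> {1..N}" for i
        using VB(1)[OF that] by (simp add: model_events_def)
      have "(\<integral>\<^sup>+t\<in>(P -` ?F \<inter> space prior). lik n x t \<partial>prior) \<le>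
          (\<integral>\<^sup>+t. (\<Sum>i\<in>{1..N}. lik n x t * indicator (P -` V i \<inter> space prior) t) \<partial>prior)"
      proof (rule nn_integral_mono)
        fix t
        show "lik n x t * indicator (P -` ?F \<inter> space prior) t \<le>
            (\<Sum>i\<in>{1..N}. lik n x t * indicator (P -` V i \<inter> space prior) t)"
        proof (cases "t \<in> P -` ?F \<inter> space prior")
          case True
          with cover obtain i where "i \<in> {1..N}" "t \<in> P -` V i \<inter> space prior"
            by auto
          with True show ?thesis
            using member_le_sum[of i "{1..N}" "\<lambda>i. lik n x t * indicator (P -` V i \<inter> space prior) t"]
            by simp
        qed simp
      qed
      also have "\<dots> = (\<Sum>i\<in>{1..N}. \<integral>\<^sup>+t\<in>(P -` V i \<inter> space prior). lik n x t \<partial>prior)"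
        by (rule nn_integral_sum) measurable
      finally show ?thesis
        unfolding posterior divide_ennreal_def sum_distrib_right [symmetric]
        by (rule mult_right_mono) simp
    qed
    have "(\<lambda>n. \<Sum>i\<in>{1..N}. posterior P p prior n x (V i)) \<longlonglongrightarrow> (\<Sum>i\<in>{1..N}. 0)"
      using elim(2) by (intro tendsto_sum) auto
    then have lim: "(\<lambda>n. \<Sum>i\<in>{1..N}. posterior P p prior n x (V i)) \<longlonglongrightarrow> 0"
      by simp
    show ?case
      by (rule tendsto_sandwich[OF _ _ tendsto_const lim]) (use le in simp_all)
  qed
qed

end
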